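(* Let $m\geq 2$ and $1\leq i\leq m-1$. Then $$\frac{d_{i-1}(m)}{\binom{m}{i-1}}\cdot\frac{d_{i+1}(m)}{\binom{m}{i+1}}>\left(\frac{d_i(m)}{\binom{m}{i}}\right)^2,$$ or equivalently, $$\frac{d_i(m)^2}{d_{i-1}(m)d_{i+1}(m)}<\frac{(m-i+1)(i+1)}{(m-i)i}.$$
   Context: For integers $m\geq 0$, the Boros-Moll polynomial is $P_m(a)=2^{-2m}\sum_{k}2^k\binom{2m-2k}{m-k}\binom{m+k}{k}(a+1)^k=\sum_{i=0}^m d_i(m)a^i$, so that $d_i(m)=2^{-2m}\sum_{k=0}^m 2^k\binom{2m-2k}{m-k}\binom{m+k}{m}\binom{k}{i}$ for $0\le i\le m$. These coefficients are positive. *)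

theory Defs
  imports Complex_Main "HOL-Computational_Algebra.Polynomial"
begin

definition boros_moll_poly :: "nat \<Rightarrow> real poly" where
  "boros_moll_poly m =
     smult (1 / 2 ^ (2 * m))
       (\<Sum>k\<le>m. smult (2 ^ k * real ((2 * m - 2 * k) choose (m - k)) * real ((m + k) choose k))
                 ([:1, 1:] ^ k))"

definition boros_moll_coeff :: "nat \<Rightarrow> nat \<Rightarrow> real" where
  "boros_moll_coeff i m = coeff (boros_moll_poly m) i"

lemma poly_boros_moll:
  "poly (boros_moll_poly m) a =
     1 / 2 ^ (2 * m) *
       (\<Sum>k\<le>m. 2 ^ k * real ((2 * m - 2 * k) choose (m - k)) * real ((m + k) choose k) * (a + 1) ^ k)"
  by (simp add: boros_moll_poly_def poly_sum add.commute)

lemma coeff_one_plus_X_power: "coeff ([:1, 1:] ^ k :: real poly) i = real (k choose i)"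
proof (induction k arbitrary: i)
  case 0
  then show ?case by (cases i) auto
next
  case (Suc k)
  then show ?case by (cases i) auto
qed

lemma boros_moll_coeff_eq:
  "boros_moll_coeff i m =
     1 / 2 ^ (2 * m) *
       (\<Sum>k=0..m. 2 ^ k * real ((2 * m - 2 * k) choose (m - k)) * real ((m + k) choose m)
                   * real (k choose i))"
proof -
  have "(m + k) choose k = (m + k) choose m" for k
    using binomial_symmetric[of k "m + k"] by simp
  then show ?thesis
    by (simp add: boros_moll_coeff_def boros_moll_poly_def coeff_sum coeff_one_plus_X_power
        atLeast0AtMost)
qed

end

theory Submission
  imports Defs
begin

text \<open>
  For fixed \<open>m\<close>, the normalised coefficients \<open>u\<^sub>i = d\<^sub>i(m) / (m choose i)\<close> satisfy the recurrence
  \<open>(m + i) u\<^sub>i\<^sub>-\<^sub>1 + (m - i) u\<^sub>i\<^sub>+\<^sub>1 = (2 m + 1) u\<^sub>i\<close> for \<open>1 \<le> i \<le> m\<close>; it comes from a telescoping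
  certificate for the defining sum. Downward induction from \<open>i = m\<close>, where the term \<open>u\<^sub>m\<^sub>+\<^sub>1\<close> drops
  out, shows that \<open>u\<close> is strictly decreasing. Combining the recurrences at \<open>i\<close> and \<open>i + 1\<close> gives
  \<open>(m + i) (u\<^sub>i\<^sup>2 - u\<^sub>i\<^sub>-\<^sub>1 u\<^sub>i\<^sub>+\<^sub>1) = (m - i - 1) (u\<^sub>i\<^sub>+\<^sub>1\<^sup>2 - u\<^sub>i u\<^sub>i\<^sub>+\<^sub>2) + u\<^sub>i\<^sub>+\<^sub>1\<^sup>2 - u\<^sub>i\<^sup>2\<close>,
  so a second downward induction yields \<open>u\<^sub>i\<^sup>2 < u\<^sub>i\<^sub>-\<^sub>1 u\<^sub>i\<^sub>+\<^sub>1\<close>.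
\<close>

section \<open>Ratios of neighbouring binomial coefficients\<close>

lemma real_Suc_times_binomial_Suc:
  "(real j + 1) * real (k choose Suc j) = (real k - real j) * real (k choose j)"
proof (cases "j \<le> k")
  case True
  have "Suc j * (k choose Suc j) = (k - j) * (k choose j)"
    using binomial_absorption[of j k] binomial_absorb_comp[of k j] by simp
  then have "real (Suc j) * real (k choose Suc j) = real (k - j) * real (k choose j)"
    by (metis of_nat_mult)
  then show ?thesis
    using True by (simp add: add.commute)
qed (simp add: binomial_eq_0)

text \<open>Two absorption steps, joined by the symmetry of row 2n + 1 about its two middle
  entries.\<close>

lemma real_central_binomial_Suc:
  "(real n + 1) * real ((2 * n + 2) choose (n + 1)) = 2 * (2 * real n + 1) * real ((2 * n) choose n)"
proof -
  have "Suc n * ((2 * n + 2) choose (n + 1)) = (2 * n + 2) * ((2 * n + 1) choose n)"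
    using Suc_times_binomial[of n "2 * n + 1"] by simp
  then have "real (Suc n) * real ((2 * n + 2) choose (n + 1))
      = real (2 * n + 2) * real ((2 * n + 1) choose n)"
    by (metis of_nat_mult)
  then have a: "(real n + 1) * real ((2 * n + 2) choose (n + 1))
      = (2 * real n + 2) * real ((2 * n + 1) choose n)"
    by (simp only: of_nat_Suc of_nat_add of_nat_mult of_nat_numeral add.commute)
  have "(2 * n + 1) choose n = (2 * n + 1) choose Suc n"
    using binomial_symmetric[of n "2 * n + 1"] by simp
  moreover have "Suc n * ((2 * n + 1) choose Suc n) = (2 * n + 1) * ((2 * n) choose n)"
    using Suc_times_binomial[of n "2 * n"] by simp
  ultimately have "real (Suc n) * real ((2 * n + 1) choose n)
      = real (2 * n + 1) * real ((2 * n) choose n)"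
    by (metis of_nat_mult)
  then have "(real n + 1) * real ((2 * n + 1) choose n)
      = (2 * real n + 1) * real ((2 * n) choose n)"
    by (simp only: of_nat_Suc of_nat_add of_nat_mult of_nat_numeral of_nat_1 add.commute)
  with a show ?thesis
    by algebra
qed

section \<open>Recurrences for the coefficients\<close>

text \<open>This is the coefficient of (a + 1)^k in 4^m P_m(a). The recurrence is homogeneous, so
  the scaling is harmless.\<close>

definition boros_moll_shifted_coeff :: "nat \<Rightarrow> nat \<Rightarrow> real" where
  "boros_moll_shifted_coeff m k =
     2 ^ k * real ((2 * m - 2 * k) choose (m - k)) * real ((m + k) choose m)"

lemma boros_moll_coeff_eq_sum_shifted:
  "boros_moll_coeff i m =
     1 / 2 ^ (2 * m) * (\<Sum>k\<le>m. boros_moll_shifted_coeff m k * real (k choose i))"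
  by (simp add: boros_moll_coeff_eq boros_moll_shifted_coeff_def atLeast0AtMost)

lemma boros_moll_shifted_coeff_pos:
  assumes "k \<le> m"
  shows "boros_moll_shifted_coeff m k > 0"
  using assms by (simp add: boros_moll_shifted_coeff_def)

text \<open>The term ratio is rational in k: the central binomial contributes one factor, with n = m
  - k - 1, and absorption in (m + k choose k) the other.\<close>

lemma boros_moll_shifted_coeff_Suc:
  assumes "k < m"
  shows "(2 * real m - 2 * real k - 1) * (real k + 1) * boros_moll_shifted_coeff m (Suc k)
       = (real m - real k) * (real m + real k + 1) * boros_moll_shifted_coeff m k"
proof -
  obtain n where m: "m = Suc (k + n)"
    using assms less_imp_Suc_add by blast
  define A where "A = real ((2 * n) choose n)"
  define A' where "A' = real ((2 * n + 2) choose (n + 1))"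
  define B where "B = real ((m + k) choose m)"
  define B' where "B' = real ((m + Suc k) choose m)"
  have A: "(real n + 1) * A' = 2 * (2 * real n + 1) * A"
    unfolding A_def A'_def by (rule real_central_binomial_Suc)
  have "Suc k * ((m + Suc k) choose Suc k) = (m + Suc k) * ((m + k) choose k)"
    using Suc_times_binomial[of k "m + k"] by simp
  moreover have "(m + Suc k) choose Suc k = (m + Suc k) choose m"
    "(m + k) choose k = (m + k) choose m"
    using binomial_symmetric[of m "m + Suc k"] binomial_symmetric[of m "m + k"] by simp_all
  ultimately have "real (Suc k) * B' = real (m + Suc k) * B"
    unfolding B_def B'_def by (metis of_nat_mult)
  then have B: "(real k + 1) * B' = (real m + real k + 1) * B"
    by (simp add: algebra_simps)
  have c: "boros_moll_shifted_coeff m k = 2 ^ k * A' * B"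
    by (simp add: boros_moll_shifted_coeff_def A'_def B_def m)
  have c': "boros_moll_shifted_coeff m (Suc k) = 2 * 2 ^ k * A * B'"
    by (simp add: boros_moll_shifted_coeff_def A_def B'_def m)
  have rm: "real m = real k + real n + 1"
    by (simp add: m)
  have "(2 * real m - 2 * real k - 1) * (real k + 1) * boros_moll_shifted_coeff m (Suc k)
      = 2 ^ k * (2 * (2 * real n + 1) * A) * ((real k + 1) * B')"
    by (simp add: c' rm)
  also have "\<dots> = 2 ^ k * ((real n + 1) * A') * ((real m + real k + 1) * B)"
    by (simp only: A B)
  also have "\<dots> = (real m - real k) * (real m + real k + 1) * boros_moll_shifted_coeff m k"
    by (simp add: c rm)
  finally show ?thesis .
qed

text \<open>
  The summand of the recurrence is \<open>G (k + 1) - G k\<close> with the certificate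
  \<open>G k = (k - j) (2 m - 2 k + 1) c\<^sub>k (k choose j)\<close>, where \<open>c\<^sub>k\<close> is the coefficient of \<open>(a + 1)\<^sup>k\<close>.
\<close>
lemma boros_moll_coeff_recurrence:
  "(real m - real j) * (real m + real j + 1) * boros_moll_coeff j m
     + (real j + 1) * (real j + 2) * boros_moll_coeff (j + 2) m
   = (real j + 1) * (2 * real m + 1) * boros_moll_coeff (Suc j) m"
proof -
  let ?c = "boros_moll_shifted_coeff m"
  let ?S = "\<lambda>i. \<Sum>k\<le>m. ?c k * real (k choose i)"
  define S where "S k = (real m - real k) * (real m + real k + 1) * ?c k * real (k choose j)" for k
  define G where "G k = (real k - real j) * (2 * real m - 2 * real k + 1) * ?c k * real (k choose j)"
    for k
  have G0: "G 0 = 0"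
    by (cases j) (simp_all add: G_def)
  have GS: "G (Suc k) = S k" if "k < m" for k
  proof -
    \<comment> \<open>Both sides equal (j + 1) (k + 1 choose j + 1).\<close>
    have "(real (Suc k) - real j) * real (Suc k choose j) = (real k + 1) * real (k choose j)"
      using real_Suc_times_binomial_Suc[of j "Suc k"] Suc_times_binomial[of j k]
      by (metis of_nat_Suc of_nat_mult add.commute)
    then have "G (Suc k) = (2 * real m - 2 * real k - 1) * (real k + 1) * ?c (Suc k)
        * real (k choose j)"
      unfolding G_def of_nat_Suc by algebra
    then show ?thesis
      by (simp only: boros_moll_shifted_coeff_Suc[OF that] S_def)
  qed
  \<comment> \<open>Both boundary terms vanish: \<open>G 0\<close> as computed, and
    \<open>S m\<close> through its factor m - k.\<close>
  have "(\<Sum>k\<le>m. G k) = (\<Sum>k<m. S k)"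
    using GS G0 by (simp add: sum.atMost_shift)
  also have "\<dots> = (\<Sum>k\<le>m. S k)"
    by (simp add: S_def flip: lessThan_Suc_atMost)
  finally have tel: "(\<Sum>k\<le>m. S k - G k) = 0"
    by (simp add: sum_subtractf)
  \<comment> \<open>Once all binomials are multiples of (k choose j), this is a polynomial identity
    in k, j and m.\<close>
  have "S k - G k = (real m - real j) * (real m + real j + 1) * (?c k * real (k choose j))
      + (real j + 1) * (real j + 2) * (?c k * real (k choose (j + 2)))
      - (real j + 1) * (2 * real m + 1) * (?c k * real (k choose Suc j))" for k
  proof -
    have b1: "(real j + 1) * real (k choose Suc j) = (real k - real j) * real (k choose j)"
      by (rule real_Suc_times_binomial_Suc)
    have b2: "(real j + 2) * real (k choose (j + 2))
        = (real k - real j - 1) * real (k choose Suc j)"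
      using real_Suc_times_binomial_Suc[of "Suc j" k] by (simp add: algebra_simps)
    have "(real j + 1) * (real j + 2) * real (k choose (j + 2))
        = (real k - real j - 1) * (real k - real j) * real (k choose j)"
      using b1 b2 by algebra
    with b1 show ?thesis
      unfolding S_def G_def by algebra
  qed
  then have "(\<Sum>k\<le>m. S k - G k) = (real m - real j) * (real m + real j + 1) * ?S j
      + (real j + 1) * (real j + 2) * ?S (j + 2) - (real j + 1) * (2 * real m + 1) * ?S (Suc j)"
    by (simp add: sum.distrib sum_subtractf sum_distrib_left del: add_2_eq_Suc')
  with tel have "(real m - real j) * (real m + real j + 1) * ?S j
      + (real j + 1) * (real j + 2) * ?S (j + 2) = (real j + 1) * (2 * real m + 1) * ?S (Suc j)"
    by simp
  then show ?thesis
    unfolding boros_moll_coeff_eq_sum_shifted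
    by (simp only: mult.left_commute[of _ "1 / 2 ^ (2 * m)"] flip: distrib_left)
qed

lemma boros_moll_coeff_pos:
  assumes "i \<le> m"
  shows "boros_moll_coeff i m > 0"
proof -
  have "(\<Sum>k\<le>m. boros_moll_shifted_coeff m k * real (k choose i)) > 0"
    using assms
    by (intro sum_pos2[of _ m]) (auto simp: boros_moll_shifted_coeff_pos less_imp_le)
  then show ?thesis
    by (simp add: boros_moll_coeff_eq_sum_shifted)
qed

text \<open>Expressing each coefficient through \<open>u\<close> brings out the common factor (j +
  1) (m choose j + 1); cancelling it leaves coefficients linear in j.\<close>

lemma boros_moll_normalized_recurrence:
  fixes m :: nat
  defines "u \<equiv> \<lambda>i. boros_moll_coeff i m / real (m choose i)"
  assumes "j < m"
  shows "(real m + real j + 1) * u j + (real m - real j - 1) * u (j + 2)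
       = (2 * real m + 1) * u (Suc j)"
proof -
  have u: "boros_moll_coeff i m = real (m choose i) * u i" if "i \<le> m" for i
    using that by (simp add: u_def)
  let ?b = "real (m choose Suc j)"
  have b1: "(real j + 1) * ?b = (real m - real j) * real (m choose j)"
    by (rule real_Suc_times_binomial_Suc)
  have b2: "(real j + 2) * real (m choose (j + 2)) = (real m - real j - 1) * ?b"
    using real_Suc_times_binomial_Suc[of "Suc j" m] by (simp add: algebra_simps)
  \<comment> \<open>For j = m - 1 the quotient \<open>u (j + 2)\<close> divides by zero; both sides
    then vanish, the right one through m - j - 1.\<close>
  have d2: "(real j + 2) * boros_moll_coeff (j + 2) m = (real m - real j - 1) * ?b * u (j + 2)"
  proof (cases "j + 2 \<le> m")
    case True
    show ?thesis
      unfolding u[OF True] using b2 by algebra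
  next
    case False
    then have "m = Suc j"
      using assms by simp
    then show ?thesis
      by (simp add: boros_moll_coeff_eq_sum_shifted binomial_eq_0 del: binomial_Suc_Suc)
  qed
  have d0: "(real m - real j) * boros_moll_coeff j m = (real j + 1) * ?b * u j"
    using u[of j] b1 assms(2) by (simp only: less_imp_le)
  have d1: "boros_moll_coeff (Suc j) m = ?b * u (Suc j)"
    using u[of "Suc j"] assms by simp
  have "((real j + 1) * ?b) * ((real m + real j + 1) * u j + (real m - real j - 1) * u (j + 2))
      = ((real j + 1) * ?b) * ((2 * real m + 1) * u (Suc j))"
    using boros_moll_coeff_recurrence[of m j] d0 d1 d2 by algebra
  moreover have "(real j + 1) * ?b \<noteq> 0"
    using assms by (simp add: add_nonneg_eq_0_iff)
  ultimately show ?thesis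
    using mult_left_cancel by blast
qed

section \<open>Monotonicity and log-convexity from the recurrence\<close>

locale boros_moll_recurrence =
  fixes m :: nat and u :: "nat \<Rightarrow> real"
  assumes pos: "i \<le> m \<Longrightarrow> u i > 0"
    and rec: "i < m \<Longrightarrow> (real m + real i + 1) * u i + (real m - real i - 1) * u (i + 2)
                = (2 * real m + 1) * u (Suc i)"
begin

lemma strictly_decreasing:
  assumes "i < m"
  shows "u (Suc i) < u i"
proof -
  have "i \<le> m - 1"
    using assms by simp
  then show ?thesis
    using assms
  proof (induction i rule: inc_induct)
    case base
    obtain n where m: "m = Suc n"
      using base by (cases m) auto
    have "(2 * real n + 2) * u n = (2 * real n + 3) * u (Suc n)"
      using rec[of n] by (simp add: m algebra_simps)
    also have "\<dots> > (2 * real n + 2) * u (Suc n)"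
      using pos[of "Suc n"] by (simp add: m)
    finally show ?case
      by (simp add: m mult_less_cancel_left_pos add_nonneg_pos)
  next
    case (step i)
    \<comment> \<open>Replacing \<open>u (i + 2)\<close> by the larger \<open>u (Suc i)\<close> in
      the recurrence leaves the factor (2m + 1) - (m - i - 1) = m + i + 2, which exceeds m + i +
      1.\<close>
    have "u (i + 2) < u (Suc i)" "0 \<le> real m - real i - 1"
      using step by simp_all
    then have "(real m - real i - 1) * u (i + 2) \<le> (real m - real i - 1) * u (Suc i)"
      by (simp add: mult_left_mono)
    then have "(real m + real i + 2) * u (Suc i) \<le> (real m + real i + 1) * u i"
      using rec[of i] step by (simp add: algebra_simps)
    moreover have "(real m + real i + 1) * u (Suc i) < (real m + real i + 2) * u (Suc i)"
      using pos[of "Suc i"] step by simp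
    ultimately have "(real m + real i + 1) * u (Suc i) < (real m + real i + 1) * u i"
      by linarith
    then show ?case
      by (simp add: mult_less_cancel_left_pos add_nonneg_pos)
  qed
qed

text \<open>Multiply the recurrence at i by \<open>u (i + 2)\<close> and the one at i + 1 by
  \<open>u (Suc i)\<close>: the right-hand sides agree, which eliminates 2m + 1.\<close>

lemma turan_identity:
  assumes "Suc i < m"
  shows "(real m + real i + 1) * (u (Suc i) ^ 2 - u i * u (i + 2))
       = (real m - real i - 2) * (u (i + 2) ^ 2 - u (Suc i) * u (i + 3))
         + u (i + 2) ^ 2 - u (Suc i) ^ 2"
proof -
  have "(real m + real i + 1) * u i + (real m - real i - 1) * u (i + 2)
      = (2 * real m + 1) * u (Suc i)"
    using rec[of i] assms by simp
  moreover have "(real m + real i + 2) * u (Suc i) + (real m - real i - 2) * u (i + 3)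
      = (2 * real m + 1) * u (i + 2)"
    using rec[of "Suc i"] assms by (simp add: algebra_simps eval_nat_numeral)
  ultimately show ?thesis
    by algebra
qed

lemma strictly_log_convex:
  assumes "Suc i < m"
  shows "u (Suc i) ^ 2 < u i * u (i + 2)"
proof -
  \<comment> \<open>This serves both induction cases: the product in \<open>le\<close> is zero at k
    = m - 2, and below that its second factor is negative by the induction hypothesis.\<close>
  have main: "u (Suc k) ^ 2 < u k * u (k + 2)"
    if k: "Suc k < m"
      and le: "(real m - real k - 2) * (u (k + 2) ^ 2 - u (Suc k) * u (k + 3)) \<le> 0" for k
  proof -
    have "u (k + 2) < u (Suc k)" "u (k + 2) > 0"
      using strictly_decreasing[of "Suc k"] pos[of "k + 2"] k by simp_all
    then have "u (k + 2) ^ 2 < u (Suc k) ^ 2"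
      by (simp add: power_strict_mono)
    then have "(real m + real k + 1) * (u (Suc k) ^ 2 - u k * u (k + 2)) < 0"
      using turan_identity[OF k] le by linarith
    then show ?thesis
      by (simp add: mult_less_0_iff)
  qed
  have "i \<le> m - 2"
    using assms by simp
  then show ?thesis
    using assms
  proof (induction i rule: inc_induct)
    case base
    then show ?case
      by (intro main) auto
  next
    case (step k)
    have "u (k + 2) ^ 2 < u (Suc k) * u (k + 3)"
      using step by (simp add: eval_nat_numeral)
    moreover have "real m - real k - 2 \<ge> 0"
      using step by simp
    ultimately show ?case
      using step by (intro main) (auto intro: mult_nonneg_nonpos)
  qed
qed

end

theorem theorem1p1:
  fixes m i :: nat
  assumes "m \<ge> 2" and "1 \<le> i" and "i \<le> m - 1"
  shows "boros_moll_coeff (i - 1) m / real (m choose (i - 1))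
           * (boros_moll_coeff (i + 1) m / real (m choose (i + 1)))
           > (boros_moll_coeff i m / real (m choose i)) ^ 2
         \<and> (boros_moll_coeff i m) ^ 2 / (boros_moll_coeff (i - 1) m * boros_moll_coeff (i + 1) m)
           < ((real m - real i + 1) * (real i + 1)) / ((real m - real i) * real i)"
proof -
  obtain j where i: "i = Suc j"
    using assms(2) by (cases i) auto
  have j: "Suc j < m"
    using assms i by simp
  define u where "u = (\<lambda>i. boros_moll_coeff i m / real (m choose i))"
  interpret boros_moll_recurrence m u
    using boros_moll_normalized_recurrence[of _ m]
    by unfold_locales (simp_all add: u_def boros_moll_coeff_pos)
  have lc: "u (Suc j) ^ 2 < u j * u (j + 2)"
    by (rule strictly_log_convex[OF j])
  let ?x = "boros_moll_coeff j m" and ?y = "boros_moll_coeff (Suc j) m"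
    and ?z = "boros_moll_coeff (j + 2) m"
  let ?a = "real (m choose j)" and ?b = "real (m choose Suc j)" and ?c = "real (m choose (j + 2))"
  have pos: "?x > 0" "?z > 0" "?a > 0" "?b > 0" "?c > 0"
    using j boros_moll_coeff_pos[of _ m] by simp_all
  have b1: "(real j + 1) * ?b = (real m - real j) * ?a"
    by (rule real_Suc_times_binomial_Suc)
  have b2: "(real j + 2) * ?c = (real m - real j - 1) * ?b"
    using real_Suc_times_binomial_Suc[of "Suc j" m] by (simp add: algebra_simps)
  have "?y ^ 2 / ?b ^ 2 < ?x * ?z / (?a * ?c)"
    using lc by (simp add: u_def power_divide)
  then have "?y ^ 2 / (?x * ?z) < ?b ^ 2 / (?a * ?c)"
    using pos by (simp add: field_simps)
  also have "?b ^ 2 / (?a * ?c)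
      = ((real m - real j) * (real j + 2)) / ((real m - real j - 1) * (real j + 1))"
  proof -
    \<comment> \<open>Here b / a = (m - j) / (j + 1) and b / c = (j + 2) / (m - j - 1), multiplied
      together.\<close>
    have "?b ^ 2 * ((real m - real j - 1) * (real j + 1))
        = ((real m - real j) * (real j + 2)) * (?a * ?c)"
      using b1 b2 by algebra
    moreover have "real m - real j - 1 > 0"
      using j by simp
    ultimately show ?thesis
      using pos by (subst frac_eq_eq) auto
  qed
  finally have "?y ^ 2 / (?x * ?z)
      < ((real m - real j) * (real j + 2)) / ((real m - real j - 1) * (real j + 1))" .
  with lc show ?thesis
    by (simp add: i u_def algebra_simps)
qed

end
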